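(* Every exact nontrivial linked chain of finite support is equivalent to $\mathfrak{u}(\mathbf{r})$ for a unique tuple $\mathbf{r}$.
   Context: Let $k$ be a field; all vector spaces are finite-dimensional over $k$. Let $\mathcal{Z}$ be the quiver with vertex set $\mathbb Z$ and, for each $i\in\mathbb Z$, an arrow $\alpha^i\colon i\to i+1$ and an arrow $\alpha_i\colon i+1\to i$. A representation of $\mathcal Z$ is written $\mathfrak{u}=(U_i,u_i,u^i)_{i\in\mathbb Z}$ with $u^i\colon U_i\to U_{i+1}$ and $u_i\colon U_{i+1}\to U_i$. For $i,j\in\mathbb Z$ put $u^i_i=\mathrm{Id}_{U_i}$, $u^i_j=u^{j-1}\circ\cdots\circ u^i$ if $j>i$, and $u^i_j=u_j\circ u_{j+1}\circ\cdots\circ u_{i-1}$ if $j<i$. The representation $\mathfrak{u}$ is a linked chain if for each $i\in\mathbb Z$: $u_i\circ u^i=0$, $u^i\circ u_i=0$, and $\ker(u_{i-1})\cap\ker(u^i)=0$. It is exact if $\ker(u^i)=\mathrm{Im}(u_i)$ and $\ker(u_i)=\mathrm{Im}(u^i)$ for each $i$; nontrivial if $U_i\neq 0$ for every $i$; and it has finite support if there is a finite $H\subseteq\mathbb Z$ such that for each $i\in\mathbb Z$ there is $j\in H$ with $u^j_i$ surjective. "Equivalent" means isomorphic as representations up to translation, i.e. identifying $\mathfrak{u}$ with $\mathfrak{u}[t]=(U_{t+i},u_{t+i},u^{t+i})_{i\in\mathbb Z}$ for every $t\in\mathbb Z$. For $d\geq 0$ and a tuple $\mathbf{r}=(r_0,\dots,r_d)$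 of nonnegative integers with $r_0,r_d\neq 0$, let $R_i=r_0+\cdots+r_i$, $S_i=r_{i+1}+\cdots+r_d$, and $r=R_d$. Define $\mathfrak{u}(\mathbf{r})=(U_i,u_i,u^i)_{i\in\mathbb Z}$ by $U_i=k^r$ (canonical basis) for all $i$, where $u^i\colon U_i\to U_{i+1}$ is the zero matrix if $i<0$, the identity if $i\geq d$, and $\mathrm{diag}(I_{R_i},0_{S_i})$ for $0\leq i<d$; and $u_i\colon U_{i+1}\to U_i$ is the zero matrix if $i\geq d$, the identity if $i<0$, and $\mathrm{diag}(0_{R_i},I_{S_i})$ for $0\leq i<d$ (here $0_a$, $I_a$ are the $a\times a$ zero and identity matrices). Then $\mathfrak{u}(\mathbf{r})$ is an exact nontrivial linked chain of pure dimension $r$ with minimal support $\{0,\dots,d\}$. *)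

theory Defs
  imports "Jordan_Normal_Form.Matrix"
begin

text \<open>A representation of the quiver Z over a field, with U_i = k^(dim i) (every
finite-dimensional k-space is isomorphic to some k^n, so no generality is lost).
upm i is the matrix of u^i : U_i -> U_(i+1), downm i the matrix of u_i : U_(i+1) -> U_i.\<close>

record 'a zrep =
  dim :: "int \<Rightarrow> nat"
  upm :: "int \<Rightarrow> 'a mat"
  downm :: "int \<Rightarrow> 'a mat"

definition well_formed :: "'a zrep \<Rightarrow> bool" where
  "well_formed u \<longleftrightarrow> (\<forall>i. upm u i \<in> carrier_mat (dim u (i+1)) (dim u i)
                        \<and> downm u i \<in> carrier_mat (dim u i) (dim u (i+1)))"

definition kernel_of :: "'a::field mat \<Rightarrow> 'a vec set" where
  "kernel_of M = {v \<in> carrier_vec (dim_col M). M *\<^sub>v v = 0\<^sub>v (dim_row M)}"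

definition image_of :: "'a::field mat \<Rightarrow> 'a vec set" where
  "image_of M = {M *\<^sub>v w | w. w \<in> carrier_vec (dim_col M)}"

definition linked_chain :: "'a::field zrep \<Rightarrow> bool" where
  "linked_chain u \<longleftrightarrow> well_formed u \<and>
     (\<forall>i. downm u i * upm u i = 0\<^sub>m (dim u i) (dim u i)
        \<and> upm u i * downm u i = 0\<^sub>m (dim u (i+1)) (dim u (i+1))
        \<and> kernel_of (downm u (i-1)) \<inter> kernel_of (upm u i) = {0\<^sub>v (dim u i)})"

definition exact_rep :: "'a::field zrep \<Rightarrow> bool" where
  "exact_rep u \<longleftrightarrow> (\<forall>i. kernel_of (upm u i) = image_of (downm u i)
                        \<and> kernel_of (downm u i) = image_of (upm u i))"

definition nontrivial_rep :: "'a zrep \<Rightarrow> bool" where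
  "nontrivial_rep u \<longleftrightarrow> (\<forall>i. dim u i \<noteq> 0)"

text \<open>upcomp u i m : U_i -> U_(i+m);  downcomp u i m : U_i -> U_(i-m).\<close>
fun upcomp :: "'a::field zrep \<Rightarrow> int \<Rightarrow> nat \<Rightarrow> 'a mat" where
  "upcomp u i 0 = 1\<^sub>m (dim u i)"
| "upcomp u i (Suc m) = upm u (i + int m) * upcomp u i m"

fun downcomp :: "'a::field zrep \<Rightarrow> int \<Rightarrow> nat \<Rightarrow> 'a mat" where
  "downcomp u i 0 = 1\<^sub>m (dim u i)"
| "downcomp u i (Suc m) = downm u (i - int m - 1) * downcomp u i m"

text \<open>path_map u i j is u^i_j : U_i -> U_j.\<close>
definition path_map :: "'a::field zrep \<Rightarrow> int \<Rightarrow> int \<Rightarrow> 'a mat" where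
  "path_map u i j = (if i \<le> j then upcomp u i (nat (j - i)) else downcomp u i (nat (i - j)))"

definition surjective_mat :: "'a::field mat \<Rightarrow> nat \<Rightarrow> bool" where
  "surjective_mat M n \<longleftrightarrow> (\<forall>w \<in> carrier_vec n. w \<in> image_of M)"

definition finite_support :: "'a::field zrep \<Rightarrow> bool" where
  "finite_support u \<longleftrightarrow> (\<exists>H :: int set. finite H \<and>
      (\<forall>i. \<exists>j \<in> H. surjective_mat (path_map u j i) (dim u i)))"

definition shift_rep :: "int \<Rightarrow> 'a zrep \<Rightarrow> 'a zrep" where
  "shift_rep t u = \<lparr>dim = (\<lambda>i. dim u (t+i)), upm = (\<lambda>i. upm u (t+i)),
                    downm = (\<lambda>i. downm u (t+i))\<rparr>"

definition iso_rep :: "'a::field zrep \<Rightarrow> 'a zrep \<Rightarrow> bool" where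
  "iso_rep u v \<longleftrightarrow> (\<exists>P :: int \<Rightarrow> 'a mat.
     \<forall>i. P i \<in> carrier_mat (dim v i) (dim u i) \<and> invertible_mat (P i)
       \<and> P (i+1) * upm u i = upm v i * P i
       \<and> P i * downm u i = downm v i * P (i+1))"

definition equivalent_rep :: "'a::field zrep \<Rightarrow> 'a zrep \<Rightarrow> bool" where
  "equivalent_rep u v \<longleftrightarrow> (\<exists>t. iso_rep u (shift_rep t v))"

text \<open>Tuples r = (r_0,...,r_d), d = length r - 1.\<close>
definition valid_tuple :: "nat list \<Rightarrow> bool" where
  "valid_tuple r \<longleftrightarrow> r \<noteq> [] \<and> hd r \<noteq> 0 \<and> last r \<noteq> 0"

definition partial_R :: "nat list \<Rightarrow> int \<Rightarrow> nat" where
  "partial_R r i = sum_list (take (nat i + 1) r)"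

definition diag_prefix :: "nat \<Rightarrow> nat \<Rightarrow> 'a::field mat" where
  "diag_prefix n a = mat n n (\<lambda>(p, q). if p = q \<and> p < a then 1 else 0)"

definition diag_suffix :: "nat \<Rightarrow> nat \<Rightarrow> 'a::field mat" where
  "diag_suffix n a = mat n n (\<lambda>(p, q). if p = q \<and> a \<le> p then 1 else 0)"

definition u_tuple :: "nat list \<Rightarrow> 'a::field zrep" where
  "u_tuple r = (let n = sum_list r; d = int (length r) - 1 in
     \<lparr>dim = (\<lambda>i. n),
      upm = (\<lambda>i. if i < 0 then 0\<^sub>m n n else if d \<le> i then 1\<^sub>m n
                 else diag_prefix n (partial_R r i)),
      downm = (\<lambda>i. if d \<le> i then 0\<^sub>m n n else if i < 0 then 1\<^sub>m n
                 else diag_suffix n (partial_R r i))\<rparr>)"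

end

(*
  By exactness, A_i = Im u^(i-1) = Ker u_(i-1) and B_i = Im u_i = Ker u^i, and the linking
  condition says that A_i and B_i meet in 0.  Choose C_i with U_i = A_i + C_i + B_i (direct);
  finite support forces C_i = 0 outside a finite interval.  Since Ker u^i = B_i, the map u^i
  carries A_i + C_i isomorphically onto A_(i+1), and dually u_i carries C_(i+1) + B_(i+1) onto
  B_i.  Pushing bases of the C_j up and down thus yields bases of all the U_i in which u^i and
  u_i are diag(I_K, 0) and diag(0, I_(N-K)), where K is the sum of dim C_j over j <= i; this is
  u(r) shifted by t, where r = (dim C_t, ..., dim C_e) and t, e are the least and the greatest
  index with C_j nonzero.
  Conversely, dim U_i and the nullity of u^i are invariant under isomorphism; for u(r) they
  determine the shift and every partial sum R_j, hence r.
*)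

theory Submission
  imports Defs "Jordan_Normal_Form.Matrix_Kernel"
begin

section \<open>Vectors and matrices\<close>

lemma map_eq_replicate: "(\<And>x. x \<in> set xs \<Longrightarrow> f x = c) \<Longrightarrow> map f xs = replicate (length xs) c"
  by (induction xs) auto

lemma split_list_at_length:
  assumes "length cs = length vs + length ws"
  obtains a b where "cs = a @ b" "length a = length vs" "length b = length ws"
  using assms by (metis append_take_drop_id length_drop length_take min.absorb2 add_diff_cancel_left' le_add1)

lemma add_eq_0_vec_iff:
  "x \<in> carrier_vec n \<Longrightarrow> y \<in> carrier_vec n \<Longrightarrow> x + y = 0\<^sub>v n \<longleftrightarrow> x = - (y :: 'a::ab_group_add vec)"
proof
  assume xy: "x \<in> carrier_vec n" "y \<in> carrier_vec n" "x + y = 0\<^sub>v n"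
  show "x = - y"
  proof (rule eq_vecI)
    fix i assume "i < dim_vec (- y)"
    then have "i < n" using xy by simp
    moreover have "(x + y) $ i = 0\<^sub>v n $ i" by (simp only: xy(3))
    ultimately show "x $ i = (- y) $ i" using xy(1,2) by (simp add: eq_neg_iff_add_eq_0)
  qed (use xy in simp)
qed auto

lemma mult_mat_vec_zero [simp]: "A \<in> carrier_mat m n \<Longrightarrow> A *\<^sub>v 0\<^sub>v n = (0\<^sub>v m :: 'a::semiring_0 vec)"
  by (intro eq_vecI) auto

lemma mult_mat_vec_uminus:
  "T \<in> carrier_mat m n \<Longrightarrow> q \<in> carrier_vec n \<Longrightarrow> T *\<^sub>v (- q) = - (T *\<^sub>v q :: 'a::ring vec)"
  by (intro eq_vecI) auto

lemma uminus_kernel_of: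
  "T \<in> carrier_mat m n \<Longrightarrow> q \<in> kernel_of T \<Longrightarrow> - q \<in> kernel_of (T :: 'a::field mat)"
  unfolding kernel_of_def by (auto simp: mult_mat_vec_uminus)

lemma image_of_eq_zero:
  assumes "M \<in> carrier_mat m n" "carrier_vec n \<subseteq> kernel_of M"
  shows "image_of M = {0\<^sub>v m :: 'a::field vec}"
  using assms unfolding image_of_def kernel_of_def by (auto intro!: exI[of _ "0\<^sub>v n"])

lemma image_of_mult_subset:
  assumes "A \<in> carrier_mat m n" "B \<in> carrier_mat n k"
  shows "image_of (A * B) \<subseteq> image_of (A :: 'a::field mat)"
proof
  fix w assume "w \<in> image_of (A * B)"
  then obtain z where "z \<in> carrier_vec k" "w = A *\<^sub>v (B *\<^sub>v z)"
    unfolding image_of_def using assms by auto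
  then show "w \<in> image_of A" unfolding image_of_def using assms by auto
qed

lemma mult_mat_vec_unit_vec:
  fixes M :: "'a::semiring_1 mat"
  assumes "M \<in> carrier_mat m n" "j < n"
  shows "M *\<^sub>v unit_vec n j = col M j"
proof (rule eq_vecI)
  fix i assume "i < dim_vec (col M j)"
  then show "(M *\<^sub>v unit_vec n j) $ i = col M j $ i"
    using assms scalar_prod_right_unit[OF assms(2), of "row M i"] by simp
qed (use assms in simp)

lemma mult_mat_of_cols:
  assumes "M \<in> carrier_mat m n" "set vs \<subseteq> carrier_vec n"
  shows "M * mat_of_cols n vs = mat_of_cols m (map ((*\<^sub>v) M) vs)"
  using assms by (intro mat_col_eqI) (auto simp: subsetD)

lemma invertible_mat_inverse:
  assumes "invertible_mat Q" "Q \<in> carrier_mat n n"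
  obtains P where "P \<in> carrier_mat n n" "P * Q = 1\<^sub>m n" "Q * P = 1\<^sub>m n"
proof -
  from assms obtain P where P: "Q * P = 1\<^sub>m n" "P * Q = 1\<^sub>m (dim_row P)"
    unfolding invertible_mat_def inverts_mat_def by auto
  have "P \<in> carrier_mat n n"
    using P assms(2) by (metis carrier_matD carrier_matI index_mult_mat(2,3) index_one_mat(2,3))
  then show ?thesis using P that by auto
qed

lemma intertwiner_inverse:
  fixes T :: "'a::semiring_1 mat"
  assumes "Q \<in> carrier_mat n n" "Q' \<in> carrier_mat m m" "T \<in> carrier_mat m n" "D \<in> carrier_mat m n"
    and "P \<in> carrier_mat n n" "P' \<in> carrier_mat m m" "Q * P = 1\<^sub>m n" "P' * Q' = 1\<^sub>m m"
    and "T * Q = Q' * D"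
  shows "P' * T = D * P"
proof -
  have "P' * T \<in> carrier_mat m n" using assms by auto
  then have "P' * T = P' * T * (Q * P)" unfolding \<open>Q * P = 1\<^sub>m n\<close> by (rule right_mult_one_mat[symmetric])
  also have "\<dots> = P' * (T * Q) * P"
    using assms assoc_mult_mat[of "P' * T" m n Q n P n] assoc_mult_mat[of P' m m T n Q n] by auto
  also have "\<dots> = (P' * Q') * D * P"
    using assms assoc_mult_mat[of P' m m Q' m D n] by auto
  also have "\<dots> = D * P" using assms by simp
  finally show ?thesis .
qed

section \<open>Linear combinations of lists of vectors\<close>

fun lcomb :: "nat \<Rightarrow> 'a::field vec list \<Rightarrow> 'a list \<Rightarrow> 'a vec" where
  "lcomb n (v # vs) (c # cs) = c \<cdot>\<^sub>v v + lcomb n vs cs"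
| "lcomb n _ _ = 0\<^sub>v n"

lemma lcomb_carrier [simp]: "set vs \<subseteq> carrier_vec n \<Longrightarrow> lcomb n vs cs \<in> carrier_vec n"
  by (induction n vs cs rule: lcomb.induct) auto

lemma lcomb_dim [simp]: "set vs \<subseteq> carrier_vec n \<Longrightarrow> dim_vec (lcomb n vs cs) = n"
  using lcomb_carrier carrier_vecD by blast

lemma lcomb_append:
  assumes "length cs = length vs" "set vs \<subseteq> carrier_vec n" "set ws \<subseteq> carrier_vec n"
  shows "lcomb n (vs @ ws) (cs @ ds) = lcomb n vs cs + lcomb n ws ds"
  using assms by (induction cs vs rule: list_induct2) (auto simp: assoc_add_vec)

lemma lcomb_append_commute:
  assumes "length cs = length vs" "length ds = length ws"
    and "set vs \<subseteq> carrier_vec n" "set ws \<subseteq> carrier_vec n"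
  shows "lcomb n (ws @ vs) (ds @ cs) = lcomb n (vs @ ws) (cs @ ds)"
  using assms by (simp add: lcomb_append comm_add_vec[of _ n])

lemma lcomb_zero_coeffs:
  "set cs \<subseteq> {0} \<Longrightarrow> set vs \<subseteq> carrier_vec n \<Longrightarrow> lcomb n vs cs = 0\<^sub>v n"
  by (induction n vs cs rule: lcomb.induct) auto

lemma lcomb_replicate_zero [simp]:
  "set vs \<subseteq> carrier_vec n \<Longrightarrow> lcomb n vs (replicate k 0) = 0\<^sub>v n"
  by (rule lcomb_zero_coeffs) auto

lemma lcomb_smult:
  "set vs \<subseteq> carrier_vec n \<Longrightarrow> a \<cdot>\<^sub>v lcomb n vs cs = lcomb n vs (map ((*) a) cs)"
proof (induction n vs cs rule: lcomb.induct)
  case (1 n v vs c cs)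
  then show ?case by (simp add: smult_add_distrib_vec[of _ n] smult_smult_assoc)
qed auto

lemma lcomb_add:
  assumes "length cs = length vs" "length ds = length vs" "set vs \<subseteq> carrier_vec n"
  shows "lcomb n vs cs + lcomb n vs ds = lcomb n vs (map2 (+) cs ds)"
  using assms
proof (induction cs vs arbitrary: ds rule: list_induct2)
  case (Cons c cs v vs)
  then obtain d ds' where ds: "ds = d # ds'" by (cases ds) auto
  have ih: "lcomb n vs cs + lcomb n vs ds' = lcomb n vs (map2 (+) cs ds')"
    using Cons ds by auto
  have "lcomb n (v # vs) (c # cs) + lcomb n (v # vs) ds
      = (c \<cdot>\<^sub>v v + d \<cdot>\<^sub>v v) + (lcomb n vs cs + lcomb n vs ds')"
    using Cons.prems ds by (intro eq_vecI) auto
  also have "\<dots> = lcomb n (v # vs) (map2 (+) (c # cs) ds)"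
    using ih Cons.prems ds by (simp add: add_smult_distrib_vec)
  finally show ?case .
qed simp

lemma mult_mat_vec_lcomb:
  "M \<in> carrier_mat m n \<Longrightarrow> set vs \<subseteq> carrier_vec n \<Longrightarrow>
    M *\<^sub>v lcomb n vs cs = lcomb m (map ((*\<^sub>v) M) vs) cs"
  by (induction n vs cs rule: lcomb.induct) (auto simp: mult_add_distrib_mat_vec mult_mat_vec)

lemma lcomb_index:
  assumes "length cs = length vs" "set vs \<subseteq> carrier_vec n" "i < n"
  shows "lcomb n vs cs $ i = (\<Sum>j<length vs. cs ! j * vs ! j $ i)"
  using assms
  by (induction cs vs rule: list_induct2)
    (auto simp del: sum.lessThan_Suc simp add: sum.lessThan_Suc_shift)

lemma mat_of_cols_mult_vec_of_list:
  assumes "length cs = length vs" "set vs \<subseteq> carrier_vec n"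
  shows "mat_of_cols n vs *\<^sub>v vec_of_list cs = lcomb n vs cs"
proof (rule eq_vecI)
  fix i assume "i < dim_vec (lcomb n vs cs)"
  then have i: "i < n" using assms(2) by simp
  have "(mat_of_cols n vs *\<^sub>v vec_of_list cs) $ i = row (mat_of_cols n vs) i \<bullet> vec_of_list cs"
    using i by simp
  also have "\<dots> = (\<Sum>j<length vs. vs ! j $ i * cs ! j)"
    unfolding scalar_prod_def using i assms(1)
    by (auto simp: mat_of_cols_index vec_of_list_index lessThan_atLeast0 intro!: sum.cong)
  also have "\<dots> = lcomb n vs cs $ i"
    using lcomb_index[OF assms i] by (simp add: mult.commute)
  finally show "(mat_of_cols n vs *\<^sub>v vec_of_list cs) $ i = lcomb n vs cs $ i" .
qed (use assms in simp)

definition lspan :: "nat \<Rightarrow> 'a::field vec list \<Rightarrow> 'a vec set" where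
  "lspan n vs = {lcomb n vs cs | cs. length cs = length vs}"

definition lin_indep :: "nat \<Rightarrow> 'a::field vec list \<Rightarrow> bool" where
  "lin_indep n vs \<longleftrightarrow> (\<forall>cs. length cs = length vs \<longrightarrow> lcomb n vs cs = 0\<^sub>v n \<longrightarrow> set cs \<subseteq> {0})"

lemma lspan_Nil [simp]: "lspan n [] = {0\<^sub>v n}"
  unfolding lspan_def by simp

lemma lspan_carrier: "set vs \<subseteq> carrier_vec n \<Longrightarrow> lspan n vs \<subseteq> carrier_vec n"
  unfolding lspan_def by auto

lemma lspan_append:
  assumes "set vs \<subseteq> carrier_vec n" "set ws \<subseteq> carrier_vec n"
  shows "lspan n (vs @ ws) = {x + y | x y. x \<in> lspan n vs \<and> y \<in> lspan n ws}"
proof (intro equalityI subsetI)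
  fix z assume "z \<in> lspan n (vs @ ws)"
  then obtain cs where cs: "length cs = length vs + length ws" "z = lcomb n (vs @ ws) cs"
    unfolding lspan_def by auto
  let ?c = "take (length vs) cs" and ?d = "drop (length vs) cs"
  have "z = lcomb n vs ?c + lcomb n ws ?d"
    using cs assms lcomb_append[of ?c vs n ws ?d] by simp
  moreover have "lcomb n vs ?c \<in> lspan n vs" "lcomb n ws ?d \<in> lspan n ws"
    unfolding lspan_def using cs by auto
  ultimately show "z \<in> {x + y | x y. x \<in> lspan n vs \<and> y \<in> lspan n ws}" by blast
next
  fix z assume "z \<in> {x + y | x y. x \<in> lspan n vs \<and> y \<in> lspan n ws}"
  then show "z \<in> lspan n (vs @ ws)"
    using assms unfolding lspan_def by (auto simp: lcomb_append[symmetric])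
qed

lemma lspan_lcomb:
  "set vs \<subseteq> carrier_vec n \<Longrightarrow> set ws \<subseteq> lspan n vs \<Longrightarrow> lcomb n ws ds \<in> lspan n vs"
proof (induction n ws ds rule: lcomb.induct)
  case (1 n w ws d ds)
  then obtain a b where ab: "length a = length vs" "w = lcomb n vs a"
    "length b = length vs" "lcomb n ws ds = lcomb n vs b"
    unfolding lspan_def by auto
  have "d \<cdot>\<^sub>v w + lcomb n ws ds = lcomb n vs (map ((*) d) a) + lcomb n vs b"
    using ab lcomb_smult[OF "1.prems"(1), of d a] by simp
  also have "\<dots> = lcomb n vs (map2 (+) (map ((*) d) a) b)"
    using ab "1.prems"(1) by (intro lcomb_add) auto
  finally show ?case unfolding lspan_def using ab by auto
qed (auto simp: lspan_def intro!: exI[of _ "replicate (length vs) 0"])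

lemma lspan_elem: "set vs \<subseteq> carrier_vec n \<Longrightarrow> v \<in> set vs \<Longrightarrow> v \<in> lspan n vs"
proof (induction vs)
  case (Cons w ws)
  show ?case
  proof (cases "v = w")
    case True
    have "lcomb n (w # ws) (1 # replicate (length ws) 0) = w"
      using Cons.prems by simp
    then show ?thesis unfolding lspan_def True by (intro CollectI exI[of _ "1 # replicate (length ws) 0"]) simp
  next
    case False
    then obtain cs where "length cs = length ws" "v = lcomb n ws cs"
      using Cons unfolding lspan_def by auto
    then have "lcomb n (w # ws) (0 # cs) = v" "length (0 # cs) = length (w # ws)"
      using Cons.prems by auto
    then show ?thesis unfolding lspan_def by blast
  qed
qed simp

lemma lspan_subset:
  "set vs \<subseteq> carrier_vec n \<Longrightarrow> set ws \<subseteq> lspan n vs \<Longrightarrow> lspan n ws \<subseteq> lspan n vs"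
  using lspan_lcomb unfolding lspan_def[of n ws] by blast

lemma lcomb_unit_vecs:
  fixes v :: "'a::field vec"
  assumes v: "v \<in> carrier_vec n"
  shows "lcomb n (unit_vecs n) (list_of_vec v) = v"
proof -
  have units: "set (unit_vecs n :: 'a vec list) \<subseteq> carrier_vec n" "length (unit_vecs n :: 'a vec list) = n"
    by (auto simp: unit_vecs_def)
  have "lcomb n (unit_vecs n) (list_of_vec v) = mat_of_cols n (unit_vecs n) *\<^sub>v vec_of_list (list_of_vec v)"
    by (rule mat_of_cols_mult_vec_of_list[symmetric]) (use v units in auto)
  also have "mat_of_cols n (unit_vecs n) = 1\<^sub>m n"
    by (intro eq_matI) (auto simp: mat_of_cols_index unit_vecs_def)
  finally show ?thesis using v by (simp add: vec_list)
qed

lemma lspan_eq_carrier: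
  assumes "set vs \<subseteq> carrier_vec n" "\<And>l. l < n \<Longrightarrow> unit_vec n l \<in> lspan n vs"
  shows "lspan n vs = carrier_vec n"
proof (intro equalityI subsetI)
  fix v :: "'a vec" assume "v \<in> carrier_vec n"
  moreover have "set (unit_vecs n) \<subseteq> lspan n vs" using assms(2) by (auto simp: unit_vecs_def)
  ultimately show "v \<in> lspan n vs"
    using lspan_lcomb[OF assms(1), of "unit_vecs n" "list_of_vec v"] lcomb_unit_vecs[of v n] by simp
qed (use lspan_carrier[OF assms(1)] in auto)

lemma image_of_eq_lspan_cols:
  assumes "M \<in> carrier_mat m k"
  shows "image_of M = lspan m (cols M)"
proof -
  have M: "mat_of_cols m (cols M) = M" using assms by (metis carrier_matD(1) mat_of_cols_cols)
  have cols: "set (cols M) \<subseteq> carrier_vec m" using assms cols_dim by blast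
  have lcomb: "lcomb m (cols M) cs = M *\<^sub>v vec_of_list cs" if "length cs = k" for cs
    using mat_of_cols_mult_vec_of_list[OF _ cols, of cs] that assms M by simp
  show ?thesis
  proof (intro equalityI subsetI)
    fix x assume "x \<in> image_of M"
    then obtain w where "w \<in> carrier_vec k" "x = M *\<^sub>v w"
      unfolding image_of_def using assms by auto
    then show "x \<in> lspan m (cols M)"
      unfolding lspan_def using lcomb[of "list_of_vec w"] assms
      by (intro CollectI exI[of _ "list_of_vec w"]) (auto simp: vec_list)
  next
    fix x assume "x \<in> lspan m (cols M)"
    then obtain cs where "length cs = k" "x = lcomb m (cols M) cs"
      unfolding lspan_def using assms by auto
    then show "x \<in> image_of M"
      unfolding image_of_def using lcomb assms
      by (intro CollectI exI[of _ "vec_of_list cs"]) (auto intro: carrier_vecI)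
  qed
qed

section \<open>Bases and bases modulo a subset\<close>

definition basis_of :: "nat \<Rightarrow> 'a::field vec set \<Rightarrow> 'a vec list \<Rightarrow> bool" where
  "basis_of n P vs \<longleftrightarrow> set vs \<subseteq> carrier_vec n \<and> lin_indep n vs \<and> lspan n vs = P"

definition lin_indep_mod :: "nat \<Rightarrow> 'a::field vec set \<Rightarrow> 'a vec list \<Rightarrow> bool" where
  "lin_indep_mod n S vs \<longleftrightarrow>
     (\<forall>cs s. length cs = length vs \<longrightarrow> s \<in> S \<longrightarrow> lcomb n vs cs + s = 0\<^sub>v n \<longrightarrow> set cs \<subseteq> {0})"

definition basis_mod :: "nat \<Rightarrow> 'a::field vec set \<Rightarrow> 'a vec list \<Rightarrow> bool" where
  "basis_mod n S vs \<longleftrightarrow> set vs \<subseteq> carrier_vec n \<and> lin_indep_mod n S vs \<and>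
     (\<forall>v \<in> carrier_vec n. \<exists>cs s. length cs = length vs \<and> s \<in> S \<and> v = lcomb n vs cs + s)"

lemma lin_indep_mod_snoc:
  assumes X: "set X \<subseteq> carrier_vec n"
    and Cs: "set Cs \<subseteq> carrier_vec n" "lin_indep_mod n (lspan n X) Cs"
    and e: "e \<in> carrier_vec n" "e \<notin> lspan n (X @ Cs)"
  shows "lin_indep_mod n (lspan n X) (Cs @ [e])"
  unfolding lin_indep_mod_def
proof (intro allI impI)
  fix cs s assume len: "length cs = length (Cs @ [e])" and s: "s \<in> lspan n X"
    and zero: "lcomb n (Cs @ [e]) cs + s = 0\<^sub>v n"
  obtain c t where ct: "cs = c @ [t]" "length c = length Cs"
    using len by (cases cs rule: rev_cases) auto
  have sc: "s \<in> carrier_vec n" using s lspan_carrier[OF X] by auto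
  define w where "w = lcomb n Cs c + s"
  have w: "w \<in> carrier_vec n" using sc Cs(1) unfolding w_def by simp
  have "w = s + lcomb n Cs c" unfolding w_def by (rule comm_add_vec[OF lcomb_carrier[OF Cs(1)] sc])
  then have "w \<in> lspan n (X @ Cs)"
    using s ct(2) unfolding lspan_append[OF X Cs(1)] lspan_def[of n Cs] by auto
  have "lcomb n (Cs @ [e]) cs + s = w + t \<cdot>\<^sub>v e"
    using ct sc Cs(1) e(1) unfolding w_def by (intro eq_vecI) (auto simp: lcomb_append)
  with zero have we: "w + t \<cdot>\<^sub>v e = 0\<^sub>v n" by simp
  have t: "t = 0"
  proof (rule ccontr)
    assume "t \<noteq> 0"
    have "e = lcomb n [w] [- 1 / t]"
    proof (rule eq_vecI)
      fix i assume "i < dim_vec (lcomb n [w] [- 1 / t])"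
      then have i: "i < n" using w by simp
      have "w $ i + t * e $ i = 0" using arg_cong[OF we, of "\<lambda>x. x $ i"] i w e(1) by simp
      then show "e $ i = lcomb n [w] [- 1 / t] $ i"
        using \<open>t \<noteq> 0\<close> i w by (simp add: field_simps add_eq_0_iff)
    qed (use w e(1) in simp)
    also have "\<dots> \<in> lspan n (X @ Cs)"
      by (rule lspan_lcomb) (use X Cs(1) \<open>w \<in> lspan n (X @ Cs)\<close> in auto)
    finally show False using e(2) by simp
  qed
  moreover have "0 \<cdot>\<^sub>v e = 0\<^sub>v n" using e(1) by (intro eq_vecI) auto
  ultimately have "lcomb n Cs c + s = 0\<^sub>v n" using we w unfolding w_def by simp
  then have "set c \<subseteq> {0}" using Cs(2) s ct(2) unfolding lin_indep_mod_def by blast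
  then show "set cs \<subseteq> {0}" using ct t by auto
qed

lemma exists_basis_mod:
  assumes X: "set X \<subseteq> carrier_vec n"
  shows "\<exists>Cs. basis_mod n (lspan n X) Cs"
proof -
  \<comment> \<open>greedily add those unit vectors that are not yet in the span\<close>
  have "\<exists>Cs. set Cs \<subseteq> carrier_vec n \<and> lin_indep_mod n (lspan n X) Cs \<and>
          (\<forall>l<k. unit_vec n l \<in> lspan n (X @ Cs))" for k
  proof (induction k)
    case 0
    show ?case by (intro exI[of _ "[]"]) (auto simp: lin_indep_mod_def)
  next
    case (Suc k)
    then obtain Cs where Cs: "set Cs \<subseteq> carrier_vec n" "lin_indep_mod n (lspan n X) Cs"
      "\<And>l. l < k \<Longrightarrow> unit_vec n l \<in> lspan n (X @ Cs)" by blast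
    let ?e = "unit_vec n k :: 'a vec"
    show ?case
    proof (cases "?e \<in> lspan n (X @ Cs)")
      case True
      then show ?thesis using Cs less_Suc_eq by (intro exI[of _ Cs]) auto
    next
      case False
      have XCs: "set (X @ Cs @ [?e]) \<subseteq> carrier_vec n" using X Cs by auto
      have "lspan n (X @ Cs) \<subseteq> lspan n (X @ Cs @ [?e])"
        by (rule lspan_subset) (use XCs lspan_elem[OF XCs] in auto)
      moreover have "?e \<in> lspan n (X @ Cs @ [?e])" by (rule lspan_elem[OF XCs]) simp
      ultimately have "\<forall>l<Suc k. unit_vec n l \<in> lspan n (X @ Cs @ [?e])"
        using Cs(3) less_Suc_eq by auto
      then show ?thesis
        using Cs lin_indep_mod_snoc[OF X Cs(1,2) _ False] by (intro exI[of _ "Cs @ [?e]"]) auto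
    qed
  qed
  then obtain Cs where Cs: "set Cs \<subseteq> carrier_vec n" "lin_indep_mod n (lspan n X) Cs"
    "\<And>l. l < n \<Longrightarrow> unit_vec n l \<in> lspan n (X @ Cs)" by blast
  have span: "lspan n (X @ Cs) = carrier_vec n" using X Cs by (intro lspan_eq_carrier) auto
  have "\<exists>cs s. length cs = length Cs \<and> s \<in> lspan n X \<and> v = lcomb n Cs cs + s"
    if "v \<in> carrier_vec n" for v
  proof -
    have "v \<in> lspan n (X @ Cs)" using that span by simp
    then obtain s cs where "s \<in> lspan n X" "length cs = length Cs" "v = s + lcomb n Cs cs"
      unfolding lspan_append[OF X Cs(1)] lspan_def[of n Cs] by auto
    moreover have "s + lcomb n Cs cs = lcomb n Cs cs + s"
      using \<open>s \<in> lspan n X\<close> lspan_carrier[OF X] Cs(1) by (auto intro: comm_add_vec)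
    ultimately show ?thesis by auto
  qed
  then show ?thesis using Cs unfolding basis_mod_def by blast
qed

lemma lin_indep_mod_Nil:
  assumes "set Cs \<subseteq> carrier_vec n" "carrier_vec n \<subseteq> S" "lin_indep_mod n S Cs"
  shows "Cs = []"
proof (rule ccontr)
  assume "Cs \<noteq> []"
  define cs where "cs = 1 # replicate (length Cs - 1) (0 :: 'a)"
  have len: "length cs = length Cs" using \<open>Cs \<noteq> []\<close> unfolding cs_def by simp
  have "- lcomb n Cs cs \<in> S" using assms(1,2) by auto
  moreover have "lcomb n Cs cs + - lcomb n Cs cs = 0\<^sub>v n" using assms(1) by simp
  ultimately have "set cs \<subseteq> {0}" using assms(3) len unfolding lin_indep_mod_def by blast
  then show False unfolding cs_def by simp
qed

lemma basis_mod_append: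
  assumes P: "basis_of n P Lp" and T: "T \<in> carrier_mat m n"
    and PT: "P \<inter> kernel_of T = {0\<^sub>v n}"
    and Cs: "basis_mod n {p + q | p q. p \<in> P \<and> q \<in> kernel_of T} Cs"
  shows "basis_mod n (kernel_of T) (Lp @ Cs)"
proof -
  have Lp: "set Lp \<subseteq> carrier_vec n" "lin_indep n Lp" "lspan n Lp = P"
    using P unfolding basis_of_def by auto
  have Cs_carrier: "set Cs \<subseteq> carrier_vec n" using Cs unfolding basis_mod_def by auto
  have ker: "kernel_of T \<subseteq> carrier_vec n" unfolding kernel_of_def using T by auto
  have "lin_indep_mod n (kernel_of T) (Lp @ Cs)"
    unfolding lin_indep_mod_def
  proof (intro allI impI)
    fix cs q assume len: "length cs = length (Lp @ Cs)" and q: "q \<in> kernel_of T"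
      and zero: "lcomb n (Lp @ Cs) cs + q = 0\<^sub>v n"
    obtain a c where ac: "cs = a @ c" "length a = length Lp" "length c = length Cs"
      using split_list_at_length[of cs Lp Cs] len by auto
    define p where "p = lcomb n Lp a"
    have p: "p \<in> P" "p \<in> carrier_vec n" using Lp ac(2) unfolding p_def lspan_def by auto
    have qc: "q \<in> carrier_vec n" using q ker by auto
    have "lcomb n Cs c + (p + q) = lcomb n (Lp @ Cs) cs + q"
      using ac Lp(1) Cs_carrier p qc unfolding p_def
      by (intro eq_vecI) (auto simp: lcomb_append)
    then have "lcomb n Cs c + (p + q) = 0\<^sub>v n" using zero by simp
    then have c: "set c \<subseteq> {0}"
      using Cs ac(3) p(1) q unfolding basis_mod_def lin_indep_mod_def by blast
    then have "p + q = 0\<^sub>v n"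
      using \<open>lcomb n Cs c + (p + q) = 0\<^sub>v n\<close> Cs_carrier p qc by (simp add: lcomb_zero_coeffs)
    then have "p = - q" using p qc add_eq_0_vec_iff by blast
    then have "p = 0\<^sub>v n" using PT p(1) uminus_kernel_of[OF T q] by auto
    then have "set a \<subseteq> {0}" using Lp(2) ac(2) unfolding lin_indep_def p_def by blast
    then show "set cs \<subseteq> {0}" using ac c by auto
  qed
  moreover have "\<exists>cs q. length cs = length (Lp @ Cs) \<and> q \<in> kernel_of T \<and> v = lcomb n (Lp @ Cs) cs + q"
    if v: "v \<in> carrier_vec n" for v
  proof -
    obtain c p q where cpq: "length c = length Cs" "p \<in> P" "q \<in> kernel_of T"
      "v = lcomb n Cs c + (p + q)"
      using Cs v unfolding basis_mod_def by blast
    obtain a where a: "length a = length Lp" "p = lcomb n Lp a"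
      using cpq(2) Lp(3) unfolding lspan_def by auto
    have "v = lcomb n (Lp @ Cs) (a @ c) + q"
      using cpq a Lp(1) Cs_carrier ker by (intro eq_vecI) (auto simp: lcomb_append)
    then show ?thesis using a cpq by (intro exI[of _ "a @ c"] exI[of _ q]) auto
  qed
  ultimately show ?thesis unfolding basis_mod_def using Lp(1) Cs_carrier by auto
qed

lemma basis_mod_kernel_image:
  assumes L: "basis_mod n (kernel_of T) L" and T: "T \<in> carrier_mat m n"
  shows "basis_of m (image_of T) (map ((*\<^sub>v) T) L)"
proof -
  have Lc: "set L \<subseteq> carrier_vec n" using L unfolding basis_mod_def by auto
  have image: "lcomb m (map ((*\<^sub>v) T) L) cs = T *\<^sub>v lcomb n L cs" for cs
    using mult_mat_vec_lcomb[OF T Lc] by simp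
  have "lin_indep m (map ((*\<^sub>v) T) L)"
    unfolding lin_indep_def
  proof (intro allI impI)
    fix cs assume len: "length cs = length (map ((*\<^sub>v) T) L)"
      and zero: "lcomb m (map ((*\<^sub>v) T) L) cs = 0\<^sub>v m"
    have "lcomb n L cs \<in> kernel_of T" using zero image T Lc unfolding kernel_of_def by auto
    then have "- lcomb n L cs \<in> kernel_of T" by (rule uminus_kernel_of[OF T])
    moreover have "lcomb n L cs + - lcomb n L cs = 0\<^sub>v n" using Lc by simp
    ultimately show "set cs \<subseteq> {0}" using L len unfolding basis_mod_def lin_indep_mod_def by auto
  qed
  moreover have "lspan m (map ((*\<^sub>v) T) L) = image_of T"
  proof (intro equalityI subsetI)
    fix w assume "w \<in> lspan m (map ((*\<^sub>v) T) L)"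
    then show "w \<in> image_of T" unfolding lspan_def image_of_def using image T Lc by auto
  next
    fix w assume "w \<in> image_of T"
    then obtain v where v: "v \<in> carrier_vec n" "w = T *\<^sub>v v" unfolding image_of_def using T by auto
    then obtain cs q where csq: "length cs = length L" "q \<in> kernel_of T" "v = lcomb n L cs + q"
      using L unfolding basis_mod_def by blast
    then have "w = T *\<^sub>v lcomb n L cs"
      using v T Lc unfolding kernel_of_def by (auto simp: mult_add_distrib_mat_vec)
    then show "w \<in> lspan m (map ((*\<^sub>v) T) L)" unfolding lspan_def using image csq by auto
  qed
  ultimately show ?thesis unfolding basis_of_def using T Lc by auto
qed

lemma basis_of_carrier_append:
  assumes L: "basis_mod n Q L" and L': "basis_of n Q L'"
  shows "basis_of n (carrier_vec n) (L @ L')"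
proof -
  have Lc: "set L \<subseteq> carrier_vec n" using L unfolding basis_mod_def by auto
  have L'c: "set L' \<subseteq> carrier_vec n" "lin_indep n L'" "lspan n L' = Q"
    using L' unfolding basis_of_def by auto
  have "lin_indep n (L @ L')"
    unfolding lin_indep_def
  proof (intro allI impI)
    fix cs assume len: "length cs = length (L @ L')" and zero: "lcomb n (L @ L') cs = 0\<^sub>v n"
    obtain a b where ab: "cs = a @ b" "length a = length L" "length b = length L'"
      using split_list_at_length[of cs L L'] len by auto
    have "lcomb n L a + lcomb n L' b = 0\<^sub>v n" using zero ab Lc L'c by (simp add: lcomb_append)
    moreover have "lcomb n L' b \<in> Q" using L'c ab unfolding lspan_def by auto
    ultimately have a: "set a \<subseteq> {0}" using L ab unfolding basis_mod_def lin_indep_mod_def by blast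
    then have "lcomb n L' b = 0\<^sub>v n"
      using \<open>lcomb n L a + lcomb n L' b = 0\<^sub>v n\<close> Lc L'c by (simp add: lcomb_zero_coeffs)
    then have "set b \<subseteq> {0}" using L'c ab unfolding lin_indep_def by blast
    then show "set cs \<subseteq> {0}" using a ab by auto
  qed
  moreover have "lspan n (L @ L') = carrier_vec n"
  proof (intro equalityI subsetI)
    fix v :: "'a vec" assume "v \<in> carrier_vec n"
    then obtain cs q where "length cs = length L" "q \<in> Q" "v = lcomb n L cs + q"
      using L unfolding basis_mod_def by blast
    moreover have "lcomb n L cs \<in> lspan n L" if "length cs = length L" for cs
      using that unfolding lspan_def by auto
    ultimately show "v \<in> lspan n (L @ L')" unfolding lspan_append[OF Lc L'c(1)] L'c(3) by auto
  qed (use lspan_carrier[of "L @ L'" n] Lc L'c in auto)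
  ultimately show ?thesis unfolding basis_of_def using Lc L'c by auto
qed

lemma basis_of_swap:
  assumes "basis_of n P (xs @ ys)"
  shows "basis_of n P (ys @ xs)"
proof -
  have c: "set xs \<subseteq> carrier_vec n" "set ys \<subseteq> carrier_vec n"
    using assms unfolding basis_of_def by auto
  have swap: "lcomb n (ys @ xs) (b @ a) = lcomb n (xs @ ys) (a @ b)"
    if "length a = length xs" "length b = length ys" for a b
    using lcomb_append_commute[OF that c] .
  have "lin_indep n (ys @ xs)"
    unfolding lin_indep_def
  proof (intro allI impI)
    fix cs assume len: "length cs = length (ys @ xs)" and zero: "lcomb n (ys @ xs) cs = 0\<^sub>v n"
    obtain b a where ba: "cs = b @ a" "length b = length ys" "length a = length xs"
      using split_list_at_length[of cs ys xs] len by auto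
    have "lcomb n (xs @ ys) (a @ b) = 0\<^sub>v n" using zero swap ba by simp
    moreover have "length (a @ b) = length (xs @ ys)" using ba by simp
    ultimately have "set (a @ b) \<subseteq> {0}"
      using assms unfolding basis_of_def lin_indep_def by blast
    then show "set cs \<subseteq> {0}" using ba by auto
  qed
  moreover have "lspan n (ys @ xs) = lspan n (xs @ ys)"
    unfolding lspan_append[OF c] lspan_append[OF c(2,1)]
    using lspan_carrier[OF c(1)] lspan_carrier[OF c(2)] by (auto; metis comm_add_vec subsetD)
  ultimately show ?thesis using assms c unfolding basis_of_def by auto
qed

lemma basis_of_in_kernel:
  "basis_of n (kernel_of M) vs \<Longrightarrow> v \<in> set vs \<Longrightarrow> M *\<^sub>v v = 0\<^sub>v (dim_row M)"
  unfolding basis_of_def kernel_of_def using lspan_elem by blast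

lemma injective_mat_dim_le:
  fixes Q :: "'a::field mat"
  assumes Q: "Q \<in> carrier_mat m k"
    and inj: "\<And>x. x \<in> carrier_vec k \<Longrightarrow> Q *\<^sub>v x = 0\<^sub>v m \<Longrightarrow> x = 0\<^sub>v k"
  shows "k \<le> m"
proof (rule ccontr)
  assume "\<not> k \<le> m"
  define r where "r i = (if i < m then row Q i else 0\<^sub>v k)" for i
  define Q' where "Q' = mat\<^sub>r k k r"
  have r: "r \<in> {0..<k} \<rightarrow> carrier_vec k" unfolding r_def using Q by auto
  have Q': "Q' \<in> carrier_mat k k" unfolding Q'_def by auto
  \<comment> \<open>padding Q with zero rows keeps it injective, yet makes it singular\<close>
  have "Q' = mat\<^sub>r k k (\<lambda>i. if i = k - 1 then 0\<^sub>v k else r i)"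
    unfolding Q'_def r_def using \<open>\<not> k \<le> m\<close> by (intro eq_matI) auto
  then have "det Q' = 0" using det_row_0[OF _ r, of "k - 1"] \<open>\<not> k \<le> m\<close> by simp
  then obtain v where v: "v \<in> carrier_vec k" "v \<noteq> 0\<^sub>v k" "Q' *\<^sub>v v = 0\<^sub>v k"
    using det_0_iff_vec_prod_zero_field[OF Q'] by auto
  have "Q *\<^sub>v v = 0\<^sub>v m"
  proof (rule eq_vecI)
    fix i assume "i < dim_vec (0\<^sub>v m :: 'a vec)"
    then have i: "i < m" by simp
    have "(Q' *\<^sub>v v) $ i = 0" using v(3) i \<open>\<not> k \<le> m\<close> by simp
    moreover have "(Q' *\<^sub>v v) $ i = (Q *\<^sub>v v) $ i"
      using i \<open>\<not> k \<le> m\<close> Q unfolding Q'_def r_def by simp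
    ultimately show "(Q *\<^sub>v v) $ i = 0\<^sub>v m $ i" using i by simp
  qed (use Q in simp)
  then show False using inj v by auto
qed

lemma basis_of_carrier_invertible:
  assumes "basis_of n (carrier_vec n) L"
  shows "length L = n" "invertible_mat (mat_of_cols n L)"
proof -
  have L: "set L \<subseteq> carrier_vec n" "lin_indep n L" "lspan n L = carrier_vec n"
    using assms unfolding basis_of_def by auto
  define k where "k = length L"
  define Q where "Q = mat_of_cols n L"
  have Q: "Q \<in> carrier_mat n k" unfolding Q_def k_def by simp
  have Qx: "Q *\<^sub>v x = lcomb n L (list_of_vec x)" if "x \<in> carrier_vec k" for x
    using mat_of_cols_mult_vec_of_list[of "list_of_vec x" L n] L(1) that
    unfolding Q_def k_def by (simp add: vec_list)
  have injQ: "x = 0\<^sub>v k" if x: "x \<in> carrier_vec k" and "Q *\<^sub>v x = 0\<^sub>v n" for x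
  proof -
    have "set (list_of_vec x) \<subseteq> {0}"
      using L(2) Qx[OF x] that unfolding lin_indep_def k_def by auto
    then show ?thesis using x by (intro eq_vecI) (auto simp: set_list_of_vec vec_set_def)
  qed
  have "\<exists>x. x \<in> carrier_vec k \<and> Q *\<^sub>v x = unit_vec n l" if "l < n" for l
  proof -
    have "unit_vec n l \<in> lspan n L" using L(3) by simp
    then obtain cs where cs: "length cs = k" "unit_vec n l = lcomb n L cs"
      unfolding lspan_def k_def by auto
    then have "Q *\<^sub>v vec_of_list cs = unit_vec n l"
      using mat_of_cols_mult_vec_of_list[of cs L n] L(1) unfolding Q_def k_def by simp
    then show ?thesis using cs by (intro exI[of _ "vec_of_list cs"]) (auto intro: carrier_vecI)
  qed
  then obtain p where p: "\<And>l. l < n \<Longrightarrow> p l \<in> carrier_vec k \<and> Q *\<^sub>v p l = unit_vec n l"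
    by metis
  define R where "R = mat_of_cols k (map p [0..<n])"
  have R: "R \<in> carrier_mat k n"
    unfolding R_def using mat_of_cols_carrier(1)[of k "map p [0..<n]"] by simp
  have QR: "Q * R = 1\<^sub>m n"
  proof (rule mat_col_eqI)
    fix l assume "l < dim_col (1\<^sub>m n :: 'a mat)"
    then have l: "l < n" by simp
    have "col (Q * R) l = Q *\<^sub>v col R l" using col_mult2[OF Q R l] .
    also have "col R l = p l" unfolding R_def using l p by simp
    finally show "col (Q * R) l = col (1\<^sub>m n) l" using p[OF l] l by simp
  qed (use Q R in auto)
  have "n \<le> k"
  proof (rule injective_mat_dim_le[OF R])
    fix y assume y: "y \<in> carrier_vec n" and "R *\<^sub>v y = 0\<^sub>v k"
    then have "(Q * R) *\<^sub>v y = 0\<^sub>v n" using Q R by simp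
    then show "y = 0\<^sub>v n" using QR y by simp
  qed
  moreover have "k \<le> n" by (rule injective_mat_dim_le[OF Q injQ])
  ultimately have "k = n" by simp
  then show "length L = n" unfolding k_def .
  have "R * Q = 1\<^sub>m n" using mat_mult_left_right_inverse[of Q n R] Q R QR \<open>k = n\<close> by simp
  then show "invertible_mat (mat_of_cols n L)"
    unfolding Q_def[symmetric] invertible_mat_def inverts_mat_def using Q R QR \<open>k = n\<close>
    by (intro conjI exI[of _ R]) auto
qed

section \<open>Diagonal idempotents and the chains u(r)\<close>

lemma diag_prefix_carrier [simp]:
  "diag_prefix n k \<in> carrier_mat n n" "dim_row (diag_prefix n k) = n" "dim_col (diag_prefix n k) = n"
  unfolding diag_prefix_def by simp_all

lemma diag_suffix_carrier [simp]:
  "diag_suffix n k \<in> carrier_mat n n" "dim_row (diag_suffix n k) = n" "dim_col (diag_suffix n k) = n"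
  unfolding diag_suffix_def by simp_all

lemma col_diag_prefix:
  "j < n \<Longrightarrow> col (diag_prefix n k) j = (if j < k then unit_vec n j else 0\<^sub>v n :: 'a::field vec)"
  unfolding diag_prefix_def by (intro eq_vecI) auto

lemma col_diag_suffix:
  "j < n \<Longrightarrow> col (diag_suffix n k) j = (if k \<le> j then unit_vec n j else 0\<^sub>v n :: 'a::field vec)"
  unfolding diag_suffix_def by (intro eq_vecI) auto

lemma mat_of_cols_mult_diag_prefix:
  assumes "set (xs @ ys) \<subseteq> carrier_vec n"
  shows "mat_of_cols n (xs @ ys) * diag_prefix (length (xs @ ys)) (length xs)
    = mat_of_cols n (xs @ replicate (length ys) (0\<^sub>v n))"
proof -
  define N where "N = length (xs @ ys)"
  have M: "mat_of_cols n (xs @ ys) \<in> carrier_mat n N" unfolding N_def by (rule mat_of_cols_carrier(1))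
  have "col (mat_of_cols n (xs @ ys) * diag_prefix N (length xs)) j
      = col (mat_of_cols n (xs @ replicate (length ys) (0\<^sub>v n))) j" if j: "j < N" for j
  proof -
    have "col (mat_of_cols n (xs @ ys) * diag_prefix N (length xs)) j
        = mat_of_cols n (xs @ ys) *\<^sub>v col (diag_prefix N (length xs)) j"
      by (rule col_mult2[OF M diag_prefix_carrier(1) j])
    also have "\<dots> = (if j < length xs then col (mat_of_cols n (xs @ ys)) j else 0\<^sub>v n)"
      using j by (simp add: col_diag_prefix mult_mat_vec_unit_vec[OF M] mult_mat_vec_zero[OF M])
    also have "\<dots> = col (mat_of_cols n (xs @ replicate (length ys) (0\<^sub>v n))) j"
      using assms j by (auto simp: N_def nth_append subsetD)
    finally show ?thesis .
  qed
  then show ?thesis unfolding N_def[symmetric] using M by (intro mat_col_eqI) (auto simp: N_def)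
qed

lemma mat_of_cols_mult_diag_suffix:
  assumes "set (xs @ ys) \<subseteq> carrier_vec n"
  shows "mat_of_cols n (xs @ ys) * diag_suffix (length (xs @ ys)) (length xs)
    = mat_of_cols n (replicate (length xs) (0\<^sub>v n) @ ys)"
proof -
  define N where "N = length (xs @ ys)"
  have M: "mat_of_cols n (xs @ ys) \<in> carrier_mat n N" unfolding N_def by (rule mat_of_cols_carrier(1))
  have "col (mat_of_cols n (xs @ ys) * diag_suffix N (length xs)) j
      = col (mat_of_cols n (replicate (length xs) (0\<^sub>v n) @ ys)) j" if j: "j < N" for j
  proof -
    have "col (mat_of_cols n (xs @ ys) * diag_suffix N (length xs)) j
        = mat_of_cols n (xs @ ys) *\<^sub>v col (diag_suffix N (length xs)) j"
      by (rule col_mult2[OF M diag_suffix_carrier(1) j])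
    also have "\<dots> = (if length xs \<le> j then col (mat_of_cols n (xs @ ys)) j else 0\<^sub>v n)"
      using j by (simp add: col_diag_suffix mult_mat_vec_unit_vec[OF M] mult_mat_vec_zero[OF M])
    also have "\<dots> = col (mat_of_cols n (replicate (length xs) (0\<^sub>v n) @ ys)) j"
      using assms j by (auto simp: N_def nth_append subsetD)
    finally show ?thesis .
  qed
  then show ?thesis unfolding N_def[symmetric] using M by (intro mat_col_eqI) (auto simp: N_def)
qed

lemma diag_prefix_0: "diag_prefix n 0 = (0\<^sub>m n n :: 'a::field mat)"
  unfolding diag_prefix_def by (intro eq_matI) auto

lemma diag_prefix_full: "diag_prefix n n = (1\<^sub>m n :: 'a::field mat)"
  unfolding diag_prefix_def by (intro eq_matI) auto

lemma diag_suffix_0: "diag_suffix n 0 = (1\<^sub>m n :: 'a::field mat)"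
  unfolding diag_suffix_def by (intro eq_matI) auto

lemma diag_suffix_full: "diag_suffix n n = (0\<^sub>m n n :: 'a::field mat)"
  unfolding diag_suffix_def by (intro eq_matI) auto

(* R_j = r_0 + ... + r_j of the paper, extended by 0 for j < 0 and by R_d for j >= d *)
definition prefix_sum :: "nat list \<Rightarrow> int \<Rightarrow> nat" where
  "prefix_sum r j = sum_list (take (nat (j + 1)) r)"

lemma u_tuple_dim [simp]: "dim (u_tuple r :: 'a::field zrep) j = sum_list r"
  unfolding u_tuple_def Let_def by simp

lemma u_tuple_upm:
  assumes "r \<noteq> []"
  shows "upm (u_tuple r :: 'a::field zrep) j = diag_prefix (sum_list r) (prefix_sum r j)"
  using assms
  unfolding u_tuple_def Let_def prefix_sum_def partial_R_def
  by (auto simp: diag_prefix_0 diag_prefix_full nat_add_distrib Suc_le_eq)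

lemma u_tuple_downm:
  assumes "r \<noteq> []"
  shows "downm (u_tuple r :: 'a::field zrep) j = diag_suffix (sum_list r) (prefix_sum r j)"
  using assms
  unfolding u_tuple_def Let_def prefix_sum_def partial_R_def
  by (auto simp: diag_suffix_0 diag_suffix_full nat_add_distrib Suc_le_eq)

lemma well_formed_u_tuple: "r \<noteq> [] \<Longrightarrow> well_formed (u_tuple r :: 'a::field zrep)"
  unfolding well_formed_def by (simp add: u_tuple_upm u_tuple_downm)

lemma well_formed_shift_rep: "well_formed u \<Longrightarrow> well_formed (shift_rep t u)"
  unfolding well_formed_def shift_rep_def by (simp, metis add.assoc)

section \<open>Uniqueness\<close>

lemma iso_rep_dim: "iso_rep u v \<Longrightarrow> dim v i = dim u i"
  unfolding iso_rep_def invertible_mat_def square_mat.simps by (metis carrier_matD)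

lemma kernel_dim_intertwined:
  fixes A :: "'a::field mat"
  assumes A: "A \<in> carrier_mat m n" and B: "B \<in> carrier_mat m n"
    and P: "P \<in> carrier_mat n n" "invertible_mat P"
    and P': "P' \<in> carrier_mat m m" "invertible_mat P'"
    and AB: "P' * A = B * P"
  shows "kernel_dim A = kernel_dim B"
proof -
  obtain R where R: "R \<in> carrier_mat n n" "P * R = 1\<^sub>m n"
    using invertible_mat_inverse[OF P(2,1)] by metis
  obtain R' where R': "R' \<in> carrier_mat m m" "R' * P' = 1\<^sub>m m" "P' * R' = 1\<^sub>m m"
    using invertible_mat_inverse[OF P'(2,1)] by metis
  have BP: "B * P \<in> carrier_mat m n" using B P by simp
  have "A = (R' * P') * A" using R' A by simp
  also have "\<dots> = R' * (P' * A)" by (rule assoc_mult_mat[OF R'(1) P'(1) A])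
  also have "\<dots> = R' * (B * P)" unfolding AB ..
  finally have "mat_kernel A = mat_kernel (B * P)"
    using mat_kernel_mult_eq[OF BP R'(1) P'(1) R'(3)] by simp
  then have "kernel_dim A = kernel_dim (B * P)"
    unfolding kernel_dim_def using A BP P(1) by simp
  also have "\<dots> = kernel_dim B"
    unfolding kernel_dim_def using mat_kernel_dim_mult_eq_right[OF B P(1) R] B P by simp
  finally show ?thesis .
qed

lemma iso_rep_kernel_dim_upm:
  assumes "well_formed u" "well_formed v" "iso_rep u v"
  shows "kernel_dim (upm u i) = kernel_dim (upm v i)"
proof -
  obtain P where P: "\<And>i. P i \<in> carrier_mat (dim v i) (dim u i)" "\<And>i. invertible_mat (P i)"
    "P (i + 1) * upm u i = upm v i * P i"
    using assms(3) unfolding iso_rep_def by blast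
  have "upm u i \<in> carrier_mat (dim u (i + 1)) (dim u i)" "upm v i \<in> carrier_mat (dim v (i + 1)) (dim v i)"
    using assms(1,2) unfolding well_formed_def by auto
  moreover have "P i \<in> carrier_mat (dim v i) (dim v i)" "P (i + 1) \<in> carrier_mat (dim v (i + 1)) (dim v (i + 1))"
    using P(1)[of i] P(1)[of "i + 1"] iso_rep_dim[OF assms(3)] by auto
  ultimately show ?thesis
    using P(2,3) iso_rep_dim[OF assms(3)]
      kernel_dim_intertwined[of "upm u i" "dim v (i + 1)" "dim v i" "upm v i" "P i" "P (i + 1)"]
    by auto
qed

lemma kernel_dim_diag_prefix:
  assumes "k \<le> n"
  shows "kernel_dim (diag_prefix n k :: 'a::field mat) = n - k"
proof -
  let ?D = "diag_prefix n k :: 'a mat"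
  have "pivot_fun ?D (\<lambda>i. if i < k then i else n) n"
    by (rule pivot_funI) (use assms in \<open>auto simp: diag_prefix_def split: if_splits\<close>)
  then have ref: "row_echelon_form ?D" unfolding row_echelon_form_def by auto
  have "row ?D i \<noteq> 0\<^sub>v n \<longleftrightarrow> i < k" if "i < n" for i
  proof
    assume "i < k"
    then have "row ?D i $ i = 1" using that by (simp add: diag_prefix_def)
    then show "row ?D i \<noteq> 0\<^sub>v n" using that by (metis index_zero_vec(1) zero_neq_one)
  qed (use that in \<open>auto simp: diag_prefix_def\<close>)
  then have "{i. i < n \<and> row ?D i \<noteq> 0\<^sub>v n} = {..<k}"
    using assms by (auto simp del: diag_prefix_def) (meson order_less_le_trans)
  then show ?thesis
    using find_base_vectors(6)[OF ref diag_prefix_carrier(1)] unfolding kernel_dim_def by simp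
qed

lemma sum_list_take_le: "sum_list (take k r) \<le> sum_list (r :: nat list)"
  by (metis append_take_drop_id le_add1 sum_list_append)

lemma sum_list_take_less:
  assumes "last r \<noteq> 0" "k < length r"
  shows "sum_list (take k r) < sum_list (r :: nat list)"
proof -
  have "last r \<in> set (drop k r)" using assms(2) by (metis drop_eq_Nil last_drop last_in_set not_le)
  then have "0 < sum_list (drop k r)" using assms(1) member_le_sum_list[of "last r"] by fastforce
  then show ?thesis by (metis append_take_drop_id less_add_same_cancel1 sum_list_append)
qed

lemma list_eq_by_prefix_sums:
  fixes r r' :: "nat list"
  assumes "last r \<noteq> 0" "last r' \<noteq> 0" and sums: "\<And>k. sum_list (take k r) = sum_list (take k r')"
  shows "r = r'"
proof (rule nth_equalityI)
  have "\<not> length r < length r'" if "last r' \<noteq> 0" "\<And>k. sum_list (take k r) = sum_list (take k r')"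
    for r r' :: "nat list"
  proof
    assume less: "length r < length r'"
    have "sum_list r' = sum_list (take (length r') r)" using that(2)[of "length r'"] by simp
    also have "\<dots> = sum_list (take (length r) r')" using less that(2)[of "length r"] by simp
    also have "\<dots> < sum_list r'" by (rule sum_list_take_less[OF that(1) less])
    finally show False by simp
  qed
  then show "length r = length r'" using assms by (metis linorder_neqE_nat)
  fix k assume "k < length r"
  then show "r ! k = r' ! k"
    using sums[of k] sums[of "Suc k"] \<open>length r = length r'\<close> by (simp add: take_Suc_conv_app_nth)
qed

lemma prefix_sum_le: "prefix_sum r j \<le> sum_list r"
  unfolding prefix_sum_def by (rule sum_list_take_le)

lemma prefix_sum_eq_0_iff:
  assumes "valid_tuple r"
  shows "prefix_sum r j = 0 \<longleftrightarrow> j < 0"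
proof
  assume "prefix_sum r j = 0"
  moreover have "hd r \<le> prefix_sum r j" if "0 \<le> j"
    using assms that unfolding valid_tuple_def prefix_sum_def
    by (cases r) (auto simp: nat_add_distrib)
  ultimately show "j < 0" using assms unfolding valid_tuple_def by force
qed (simp add: prefix_sum_def)

lemma u_tuple_equivalence_unique:
  fixes u :: "'a::field zrep"
  assumes u: "well_formed u" and r: "valid_tuple r" and r': "valid_tuple r'"
    and "equivalent_rep u (u_tuple r)" "equivalent_rep u (u_tuple r')"
  shows "r = r'"
proof -
  obtain t t' where iso: "iso_rep u (shift_rep t (u_tuple r))" "iso_rep u (shift_rep t' (u_tuple r'))"
    using assms(4,5) unfolding equivalent_rep_def by blast
  have ne: "r \<noteq> []" "r' \<noteq> []" using r r' unfolding valid_tuple_def by auto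
  have n: "dim u i = sum_list r" "dim u i = sum_list r'" for i
    using iso_rep_dim[OF iso(1)] iso_rep_dim[OF iso(2)] by (auto simp: shift_rep_def)
  have "kernel_dim (upm u i) = sum_list r - prefix_sum r (t + i)"
       "kernel_dim (upm u i) = sum_list r' - prefix_sum r' (t' + i)" for i
    using iso_rep_kernel_dim_upm[OF u well_formed_shift_rep[OF well_formed_u_tuple] iso(1)]
      iso_rep_kernel_dim_upm[OF u well_formed_shift_rep[OF well_formed_u_tuple] iso(2)] ne
    by (auto simp: shift_rep_def u_tuple_upm kernel_dim_diag_prefix prefix_sum_le)
  then have eq: "prefix_sum r (t + i) = prefix_sum r' (t' + i)" for i
    using n[of 0] prefix_sum_le[of r] prefix_sum_le[of r'] by (metis diff_diff_cancel)
  have "prefix_sum r' (t' - t) = prefix_sum r 0" "prefix_sum r (t - t') = prefix_sum r' 0"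
    using eq[of "- t"] eq[of "- t'"] by simp_all
  then have "\<not> t' - t < 0" "\<not> t - t' < 0"
    using prefix_sum_eq_0_iff[OF r] prefix_sum_eq_0_iff[OF r'] by (metis less_irrefl)+
  then have "t = t'" by simp
  then have "sum_list (take k r) = sum_list (take k r')" for k
    using eq[of "int k - 1 - t"] unfolding prefix_sum_def by simp
  then show "r = r'" using r r' unfolding valid_tuple_def by (intro list_eq_by_prefix_sums) auto
qed

section \<open>Existence\<close>

lemma upcomp_carrier: "well_formed u \<Longrightarrow> upcomp u j m \<in> carrier_mat (dim u (j + int m)) (dim u j)"
proof (induction m)
  case (Suc m)
  have "upm u (j + int m) \<in> carrier_mat (dim u (j + int m + 1)) (dim u (j + int m))"
    using Suc.prems unfolding well_formed_def by auto
  moreover have e: "j + int (Suc m) = j + int m + 1" by simp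
  ultimately show ?case unfolding e upcomp.simps using mult_carrier_mat Suc by blast
qed simp

lemma downcomp_carrier: "well_formed u \<Longrightarrow> downcomp u j m \<in> carrier_mat (dim u (j - int m)) (dim u j)"
proof (induction m)
  case (Suc m)
  have "downm u (j - int m - 1) \<in> carrier_mat (dim u (j - int m - 1)) (dim u (j - int m))"
    using Suc.prems unfolding well_formed_def by (metis diff_add_cancel)
  moreover have e: "j - int (Suc m) = j - int m - 1" by simp
  ultimately show ?case unfolding e downcomp.simps using mult_carrier_mat Suc by blast
qed simp

lemma path_map_carrier: "well_formed u \<Longrightarrow> path_map u j i \<in> carrier_mat (dim u i) (dim u j)"
  unfolding path_map_def using upcomp_carrier[of u j "nat (i - j)"] downcomp_carrier[of u j "nat (j - i)"]
  by auto

lemma path_map_up: "j \<le> i \<Longrightarrow> path_map u j (i + 1) = upm u i * path_map u j i"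
proof -
  assume "j \<le> i"
  then have "nat (i + 1 - j) = Suc (nat (i - j))" "j + int (nat (i - j)) = i" by simp_all
  then show ?thesis unfolding path_map_def using \<open>j \<le> i\<close> by simp
qed

lemma path_map_down: "i < j \<Longrightarrow> path_map u j i = downm u i * path_map u j (i + 1)"
proof -
  assume "i < j"
  moreover have "path_map u j (i + 1) = downcomp u j (nat (j - (i + 1)))"
    unfolding path_map_def using \<open>i < j\<close> by (cases "j = i + 1") auto
  ultimately have "nat (j - i) = Suc (nat (j - (i + 1)))" "j - int (nat (j - (i + 1))) - 1 = i"
    "path_map u j (i + 1) = downcomp u j (nat (j - (i + 1)))" by simp_all
  then show ?thesis unfolding path_map_def using \<open>i < j\<close> by simp
qed

lemma finite_support_bounds:
  fixes u :: "'a::field zrep"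
  assumes "well_formed u" "finite_support u"
  obtains lo hi where
    "\<And>i. i < lo \<Longrightarrow> carrier_vec (dim u i) \<subseteq> image_of (downm u i)"
    "\<And>i. hi \<le> i \<Longrightarrow> carrier_vec (dim u (i + 1)) \<subseteq> image_of (upm u i)"
proof -
  from assms(2) obtain H :: "int set"
    where H: "finite H" "\<And>i. \<exists>j\<in>H. surjective_mat (path_map u j i) (dim u i)"
    unfolding finite_support_def by blast
  have "H \<noteq> {}" using H(2)[of 0] by auto
  have carrier: "upm u i \<in> carrier_mat (dim u (i + 1)) (dim u i)"
    "downm u i \<in> carrier_mat (dim u i) (dim u (i + 1))" "path_map u j i \<in> carrier_mat (dim u i) (dim u j)"
    for i j using assms(1) path_map_carrier unfolding well_formed_def by blast+
  show ?thesis
  proof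
    fix i assume "i < Min H"
    obtain j where j: "j \<in> H" "surjective_mat (path_map u j i) (dim u i)" using H(2) by blast
    then have "i < j" using \<open>i < Min H\<close> H(1) by (meson Min_le not_le order_le_less_trans)
    then show "carrier_vec (dim u i) \<subseteq> image_of (downm u i)"
      using j(2) image_of_mult_subset[OF carrier(2,3)] path_map_down[of i j u]
      unfolding surjective_mat_def by auto
  next
    fix i assume "Max H \<le> i"
    obtain j where j: "j \<in> H" "surjective_mat (path_map u j (i + 1)) (dim u (i + 1))" using H(2) by blast
    then have "j \<le> i" using \<open>Max H \<le> i\<close> H(1) by (meson Max_ge order_trans)
    then show "carrier_vec (dim u (i + 1)) \<subseteq> image_of (upm u i)"
      using j(2) image_of_mult_subset[OF carrier(1,3)] path_map_up[of j i u]
      unfolding surjective_mat_def by auto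
  qed
qed

lemma take_upto: "take (nat (j - i + 1)) [i..k] = [i..min j k]"
proof (cases "i \<le> j \<and> j < k")
  case True
  then have "[i..k] = [i..j] @ [j + 1..k]" by (intro upto_split2) auto
  then show ?thesis using True by simp
qed auto

lemma tuple_of_counts:
  fixes f :: "int \<Rightarrow> nat"
  assumes supp: "\<And>j. f j \<noteq> 0 \<Longrightarrow> lo \<le> j \<and> j \<le> hi" and "f j0 \<noteq> 0"
  obtains r t where "valid_tuple r" "\<And>i. prefix_sum r (i - t) = (\<Sum>j\<in>{lo..i}. f j)"
proof -
  define S where "S = {j. f j \<noteq> 0}"
  have "S \<subseteq> {lo..hi}" using supp unfolding S_def by auto
  then have S: "finite S" "S \<noteq> {}" "S \<subseteq> {lo..hi}"
    using assms(2) finite_subset unfolding S_def by auto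
  define t where "t = Min S"
  define e where "e = Max S"
  have te: "t \<in> S" "e \<in> S" "t \<le> e" "lo \<le> t" "e \<le> hi"
    using S unfolding t_def e_def by auto
  have outside: "f j = 0" if "j < t \<or> e < j" for j
    using that S unfolding t_def e_def S_def by (metis (mono_tags) Max_ge Min_le mem_Collect_eq not_le)
  define r where "r = map f [t..e]"
  have "hd r = f t" unfolding r_def upto_rec1[OF te(3)] by simp
  moreover have "last r = f e" unfolding r_def upto_rec2[OF te(3)] by simp
  moreover have "r \<noteq> []" unfolding r_def using te(3) by simp
  ultimately have "valid_tuple r" using te unfolding valid_tuple_def S_def by auto
  moreover have "prefix_sum r (i - t) = (\<Sum>j\<in>{lo..i}. f j)" for i
  proof -
    have "prefix_sum r (i - t) = (\<Sum>j\<in>{t..min i e}. f j)"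
      unfolding prefix_sum_def r_def take_map take_upto[of i t e, simplified]
      by (simp add: interv_sum_list_conv_sum_set_int)
    also have "\<dots> = (\<Sum>j\<in>{lo..i}. f j)"
      by (rule sum.mono_neutral_left) (use te outside in auto)
    finally show ?thesis .
  qed
  ultimately show ?thesis using that by blast
qed

lemma iso_rep_of_intertwiners:
  assumes u: "well_formed u" "\<And>i. dim u i = n" and v: "well_formed v" "\<And>i. dim v i = n"
    and Q: "\<And>i. Q i \<in> carrier_mat n n" "\<And>i. invertible_mat (Q i)"
    and up: "\<And>i. upm u i * Q i = Q (i + 1) * upm v i"
    and down: "\<And>i. downm u i * Q (i + 1) = Q i * downm v i"
  shows "iso_rep u v"
proof -
  have "\<exists>P. P \<in> carrier_mat n n \<and> P * Q i = 1\<^sub>m n \<and> Q i * P = 1\<^sub>m n" for i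
    by (rule invertible_mat_inverse[OF Q(2) Q(1)]) blast
  then obtain P where P: "\<And>i. P i \<in> carrier_mat n n" "\<And>i. P i * Q i = 1\<^sub>m n" "\<And>i. Q i * P i = 1\<^sub>m n"
    by metis
  have "invertible_mat (P i)" for i
    unfolding invertible_mat_def inverts_mat_def using P[of i] Q(1)[of i] by auto
  moreover have "upm u i \<in> carrier_mat n n" "downm u i \<in> carrier_mat n n"
    "upm v i \<in> carrier_mat n n" "downm v i \<in> carrier_mat n n" for i
    using u v unfolding well_formed_def by auto
  ultimately show ?thesis
    unfolding iso_rep_def using Q(1) P u(2) v(2)
    by (intro exI[of _ P] allI conjI intertwiner_inverse[OF _ _ _ _ _ _ _ _ up]
        intertwiner_inverse[OF _ _ _ _ _ _ _ _ down]) auto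
qed

locale exact_linked_chain =
  fixes u :: "'a::field zrep" and lo hi :: int
  assumes linked: "linked_chain u" and exact: "exact_rep u"
    and surj_below: "\<And>i. i < lo \<Longrightarrow> carrier_vec (dim u i) \<subseteq> image_of (downm u i)"
    and surj_above: "\<And>i. hi \<le> i \<Longrightarrow> carrier_vec (dim u (i + 1)) \<subseteq> image_of (upm u i)"
begin

lemma well_formed: "well_formed u"
  using linked unfolding linked_chain_def by auto

lemma upm_carrier: "upm u i \<in> carrier_mat (dim u (i + 1)) (dim u i)"
  and downm_carrier: "downm u i \<in> carrier_mat (dim u i) (dim u (i + 1))"
  using well_formed unfolding well_formed_def by auto

definition A :: "int \<Rightarrow> 'a vec set" where
  "A i = image_of (upm u (i - 1))"

definition B :: "int \<Rightarrow> 'a vec set" where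
  "B i = image_of (downm u i)"

lemma A_kernel: "A (i + 1) = kernel_of (downm u i)"
  using exact unfolding exact_rep_def A_def by simp

lemma B_kernel: "B i = kernel_of (upm u i)"
  using exact unfolding exact_rep_def B_def by simp

lemma A_inter_B: "A i \<inter> B i = {0\<^sub>v (dim u i)}"
  using linked A_kernel[of "i - 1"] B_kernel[of i] unfolding linked_chain_def by simp

lemma A_carrier: "A i \<subseteq> carrier_vec (dim u i)"
  unfolding A_def image_of_def using upm_carrier[of "i - 1"] by auto

lemma B_carrier: "B i \<subseteq> carrier_vec (dim u i)"
  unfolding B_def image_of_def using downm_carrier[of i] by auto

lemma A_below: "i \<le> lo \<Longrightarrow> A i = {0\<^sub>v (dim u i)}"
  using image_of_eq_zero[OF upm_carrier[of "i - 1"]] surj_below[of "i - 1"] B_kernel[of "i - 1"]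
  unfolding A_def B_def by simp

lemma B_above: "hi \<le> i \<Longrightarrow> B i = {0\<^sub>v (dim u i)}"
  using image_of_eq_zero[OF downm_carrier[of i]] surj_above[of i] A_kernel[of i]
  unfolding A_def B_def by simp

lemma A_above: "hi < i \<Longrightarrow> A i = carrier_vec (dim u i)"
  using surj_above[of "i - 1"] A_carrier[of i] unfolding A_def by auto

lemma B_below: "i < lo \<Longrightarrow> B i = carrier_vec (dim u i)"
  using surj_below[of i] B_carrier[of i] unfolding B_def by auto

definition C :: "int \<Rightarrow> 'a vec list" where
  "C i = (SOME Cs. basis_mod (dim u i) {p + q | p q. p \<in> A i \<and> q \<in> B i} Cs)"

lemma C_basis_mod: "basis_mod (dim u i) {p + q | p q. p \<in> A i \<and> q \<in> B i} (C i)"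
proof -
  let ?X = "cols (upm u (i - 1)) @ cols (downm u i)"
  have cols: "set (cols (upm u (i - 1))) \<subseteq> carrier_vec (dim u i)"
    "set (cols (downm u i)) \<subseteq> carrier_vec (dim u i)"
    using upm_carrier[of "i - 1"] downm_carrier[of i] cols_dim by (metis carrier_matD(1) diff_add_cancel)+
  have "lspan (dim u i) ?X = {p + q | p q. p \<in> A i \<and> q \<in> B i}"
    unfolding lspan_append[OF cols] A_def B_def
      image_of_eq_lspan_cols[OF upm_carrier[of "i - 1", simplified]]
      image_of_eq_lspan_cols[OF downm_carrier[of i]] ..
  moreover have "\<exists>Cs. basis_mod (dim u i) (lspan (dim u i) ?X) Cs"
    by (rule exists_basis_mod) (use cols in auto)
  ultimately have "\<exists>Cs. basis_mod (dim u i) {p + q | p q. p \<in> A i \<and> q \<in> B i} Cs" by simp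
  then show ?thesis unfolding C_def by (rule someI_ex)
qed

lemma C_carrier: "set (C i) \<subseteq> carrier_vec (dim u i)"
  using C_basis_mod unfolding basis_mod_def by blast

lemma C_outside: "i < lo \<or> hi < i \<Longrightarrow> C i = []"
proof -
  assume i: "i < lo \<or> hi < i"
  have zero: "0\<^sub>v (dim u i) \<in> A i" "0\<^sub>v (dim u i) \<in> B i" using A_inter_B by auto
  have "carrier_vec (dim u i) \<subseteq> {p + q | p q. p \<in> A i \<and> q \<in> B i}"
  proof
    fix v :: "'a vec" assume v: "v \<in> carrier_vec (dim u i)"
    show "v \<in> {p + q | p q. p \<in> A i \<and> q \<in> B i}"
    proof (cases "i < lo")
      case True
      then have "v = 0\<^sub>v (dim u i) + v" "v \<in> B i" using v B_below by auto
      then show ?thesis using zero(1) by blast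
    next
      case False
      then have "v = v + 0\<^sub>v (dim u i)" "v \<in> A i" using i v A_above by auto
      then show ?thesis using zero(2) by blast
    qed
  qed
  then show ?thesis using lin_indep_mod_Nil C_carrier C_basis_mod unfolding basis_mod_def by blast
qed

fun push_up :: "nat \<Rightarrow> 'a vec list" where
  "push_up 0 = []"
| "push_up (Suc k) = map ((*\<^sub>v) (upm u (lo + int k))) (push_up k @ C (lo + int k))"

fun push_down :: "nat \<Rightarrow> 'a vec list" where
  "push_down 0 = []"
| "push_down (Suc k) = map ((*\<^sub>v) (downm u (hi - int k - 1))) (C (hi - int k) @ push_down k)"

definition A_basis :: "int \<Rightarrow> 'a vec list" where
  "A_basis i = push_up (nat (i - lo))"

definition B_basis :: "int \<Rightarrow> 'a vec list" where
  "B_basis i = push_down (nat (hi - i))"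

lemma A_basis_step: "A_basis (i + 1) = map ((*\<^sub>v) (upm u i)) (A_basis i @ C i)"
proof (cases "lo \<le> i")
  case True
  then have "nat (i + 1 - lo) = Suc (nat (i - lo))" "lo + int (nat (i - lo)) = i" by simp_all
  then show ?thesis unfolding A_basis_def by simp
next
  case False
  then show ?thesis unfolding A_basis_def using C_outside[of i] by simp
qed

lemma B_basis_step: "B_basis i = map ((*\<^sub>v) (downm u i)) (C (i + 1) @ B_basis (i + 1))"
proof (cases "i < hi")
  case True
  then have "nat (hi - i) = Suc (nat (hi - (i + 1)))" "hi - int (nat (hi - (i + 1))) = i + 1"
    "hi - int (nat (hi - (i + 1))) - 1 = i" by simp_all
  then show ?thesis unfolding B_basis_def by (simp only: push_down.simps)
next
  case False
  then show ?thesis unfolding B_basis_def using C_outside[of "i + 1"] by simp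
qed

lemma A_basis: "basis_of (dim u i) (A i) (A_basis i)"
proof (induction i rule: int_induct[where k = lo])
  case base
  show ?case using A_below[of lo] unfolding A_basis_def basis_of_def lin_indep_def by simp
next
  case (step1 i)
  have "basis_mod (dim u i) (kernel_of (upm u i)) (A_basis i @ C i)"
    using basis_mod_append[OF step1.IH upm_carrier] A_inter_B C_basis_mod B_kernel by simp
  from basis_mod_kernel_image[OF this upm_carrier] show ?case
    unfolding A_basis_step A_def by simp
next
  case (step2 i)
  then show ?case using A_below[of "i - 1"] unfolding A_basis_def basis_of_def lin_indep_def by simp
qed

lemma B_basis: "basis_of (dim u i) (B i) (B_basis i)"
proof (induction i rule: int_induct[where k = hi])
  case base
  show ?case using B_above[of hi] unfolding B_basis_def basis_of_def lin_indep_def by simp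
next
  case (step1 i)
  then show ?case using B_above[of "i + 1"] unfolding B_basis_def basis_of_def lin_indep_def by simp
next
  case (step2 i)
  have G: "downm u (i - 1) \<in> carrier_mat (dim u (i - 1)) (dim u i)"
    using downm_carrier[of "i - 1"] by simp
  have ker: "kernel_of (downm u (i - 1)) = A i" using A_kernel[of "i - 1"] by simp
  have "{p + q | p q. p \<in> B i \<and> q \<in> A i} = {p + q | p q. p \<in> A i \<and> q \<in> B i}"
    using A_carrier[of i] B_carrier[of i] by (auto; metis comm_add_vec subsetD)
  then have "basis_mod (dim u i) {p + q | p q. p \<in> B i \<and> q \<in> kernel_of (downm u (i - 1))} (C i)"
    using C_basis_mod[of i] unfolding ker by simp
  moreover have "B i \<inter> kernel_of (downm u (i - 1)) = {0\<^sub>v (dim u i)}"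
    using A_inter_B[of i] unfolding ker by blast
  ultimately have "basis_mod (dim u i) (kernel_of (downm u (i - 1))) (B_basis i @ C i)"
    using basis_mod_append[OF step2.IH G] by blast
  from basis_mod_kernel_image[OF this G]
  have "basis_of (dim u (i - 1)) (B (i - 1))
      (map ((*\<^sub>v) (downm u (i - 1))) (B_basis i) @ map ((*\<^sub>v) (downm u (i - 1))) (C i))"
    unfolding B_def by simp
  from basis_of_swap[OF this] show ?case using B_basis_step[of "i - 1"] by simp
qed

definition chain_basis :: "int \<Rightarrow> 'a vec list" where
  "chain_basis i = A_basis i @ C i @ B_basis i"

lemma chain_basis: "basis_of (dim u i) (carrier_vec (dim u i)) (chain_basis i)"
proof -
  have "basis_mod (dim u i) (kernel_of (upm u i)) (A_basis i @ C i)"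
    using basis_mod_append[OF A_basis upm_carrier] A_inter_B C_basis_mod B_kernel by simp
  from basis_of_carrier_append[OF this] show ?thesis
    using B_basis B_kernel unfolding chain_basis_def by simp
qed

lemma dim_succ: "dim u (i + 1) = dim u i"
proof -
  have "length (B_basis i) = length (C (i + 1)) + length (B_basis (i + 1))"
    using B_basis_step[of i] by simp
  then have "length (chain_basis (i + 1)) = length (chain_basis i)"
    unfolding chain_basis_def A_basis_step by simp
  then show ?thesis using basis_of_carrier_invertible(1)[OF chain_basis] by metis
qed

definition N :: nat where
  "N = dim u 0"

lemma dim_eq: "dim u i = N"
  unfolding N_def
  by (induction i rule: int_induct[where k = 0]) (auto simp: dim_succ dim_succ[of "_ - 1", symmetric])

definition up_rank :: "int \<Rightarrow> nat" where
  "up_rank i = length (A_basis (i + 1))"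

lemma length_chain_basis: "length (chain_basis i) = N"
  using basis_of_carrier_invertible(1)[OF chain_basis] dim_eq by simp

lemma chain_basis_carrier: "set (chain_basis i) \<subseteq> carrier_vec N"
  using chain_basis[of i] dim_eq unfolding basis_of_def by simp

lemma upm_mult_chain_basis:
  "upm u i * mat_of_cols N (chain_basis i) = mat_of_cols N (chain_basis (i + 1)) * diag_prefix N (up_rank i)"
proof -
  have F: "upm u i \<in> carrier_mat N N" using upm_carrier[of i] dim_eq by simp
  have "map ((*\<^sub>v) (upm u i)) (B_basis i) = replicate (length (B_basis i)) (0\<^sub>v N)"
    using basis_of_in_kernel[OF B_basis[of i, unfolded B_kernel]] F by (intro map_eq_replicate) simp
  moreover have "length (B_basis i) = length (C (i + 1) @ B_basis (i + 1))"
    using B_basis_step[of i] by simp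
  ultimately have "map ((*\<^sub>v) (upm u i)) (chain_basis i)
      = A_basis (i + 1) @ replicate (length (C (i + 1) @ B_basis (i + 1))) (0\<^sub>v N)"
    unfolding chain_basis_def A_basis_step by simp
  then show ?thesis
    using mult_mat_of_cols[OF F chain_basis_carrier]
      mat_of_cols_mult_diag_prefix[of "A_basis (i + 1)" "C (i + 1) @ B_basis (i + 1)" N]
      chain_basis_carrier[of "i + 1"] length_chain_basis[of "i + 1"]
    unfolding chain_basis_def up_rank_def by simp
qed

lemma downm_mult_chain_basis:
  "downm u i * mat_of_cols N (chain_basis (i + 1)) = mat_of_cols N (chain_basis i) * diag_suffix N (up_rank i)"
proof -
  have G: "downm u i \<in> carrier_mat N N" using downm_carrier[of i] dim_eq by simp
  have "map ((*\<^sub>v) (downm u i)) (A_basis (i + 1)) = replicate (length (A_basis (i + 1))) (0\<^sub>v N)"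
    using basis_of_in_kernel[OF A_basis[of "i + 1", unfolded A_kernel]] G by (intro map_eq_replicate) simp
  then have "map ((*\<^sub>v) (downm u i)) (chain_basis (i + 1)) = replicate (up_rank i) (0\<^sub>v N) @ B_basis i"
    unfolding chain_basis_def B_basis_step[of i] up_rank_def by simp
  moreover have "up_rank i = length (A_basis i @ C i)" unfolding up_rank_def A_basis_step by simp
  moreover have "chain_basis i = (A_basis i @ C i) @ B_basis i" unfolding chain_basis_def by simp
  ultimately show ?thesis
    using mult_mat_of_cols[OF G chain_basis_carrier]
      mat_of_cols_mult_diag_suffix[of "A_basis i @ C i" "B_basis i" N]
      chain_basis_carrier[of i] length_chain_basis[of i]
    by simp
qed

definition diag_rep :: "'a zrep" where
  "diag_rep = \<lparr>dim = (\<lambda>i. N), upm = (\<lambda>i. diag_prefix N (up_rank i)),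
    downm = (\<lambda>i. diag_suffix N (up_rank i))\<rparr>"

lemma iso_diag_rep: "iso_rep u diag_rep"
proof (rule iso_rep_of_intertwiners[where Q = "\<lambda>i. mat_of_cols N (chain_basis i)"])
  show "well_formed diag_rep" unfolding well_formed_def diag_rep_def by simp
  show "invertible_mat (mat_of_cols N (chain_basis i))" for i
    using basis_of_carrier_invertible(2)[OF chain_basis[of i]] dim_eq by simp
qed (use well_formed dim_eq length_chain_basis upm_mult_chain_basis downm_mult_chain_basis
  in \<open>auto simp: diag_rep_def\<close>)

lemma length_A_basis: "length (A_basis i) = (\<Sum>j\<in>{lo..<i}. length (C j))"
proof (induction i rule: int_induct[where k = lo])
  case (step1 i)
  have "{lo..<i + 1} = insert i {lo..<i}" using step1(1) by auto
  then show ?case using step1 A_basis_step[of i] by simp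
qed (simp_all add: A_basis_def)

lemma up_rank_eq_sum: "up_rank i = (\<Sum>j\<in>{lo..i}. length (C j))"
  unfolding up_rank_def length_A_basis atLeastLessThanPlusOne_atLeastAtMost_int ..

lemma up_rank_above: "hi \<le> i \<Longrightarrow> up_rank i = N"
  using length_chain_basis[of i] unfolding chain_basis_def up_rank_def A_basis_step B_basis_def by simp

lemma exists_equivalent_u_tuple:
  assumes "N \<noteq> 0"
  shows "\<exists>r. valid_tuple r \<and> equivalent_rep u (u_tuple r)"
proof -
  have "(\<Sum>j\<in>{lo..hi}. length (C j)) \<noteq> 0" using assms up_rank_above[of hi] up_rank_eq_sum by simp
  then obtain j0 where "length (C j0) \<noteq> 0" by (meson sum.neutral)
  moreover have "length (C j) \<noteq> 0 \<Longrightarrow> lo \<le> j \<and> j \<le> hi" for j using C_outside by force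
  ultimately obtain r t where r: "valid_tuple r" and t: "\<And>i. prefix_sum r (i - t) = up_rank i"
    using tuple_of_counts[of "\<lambda>j. length (C j)"] unfolding up_rank_eq_sum by metis
  define i where "i = max hi (t + int (length r))"
  have "sum_list r = prefix_sum r (i - t)" unfolding prefix_sum_def i_def by simp
  also have "\<dots> = N" using t up_rank_above[of i] unfolding i_def by simp
  finally have "shift_rep (- t) (u_tuple r) = diag_rep"
    using r t unfolding shift_rep_def diag_rep_def valid_tuple_def
    by (simp add: u_tuple_upm u_tuple_downm)
  then show ?thesis using r iso_diag_rep unfolding equivalent_rep_def by metis
qed

end

theorem proposition3p2:
  fixes u :: "'a::field zrep"
  assumes "linked_chain u" and "exact_rep u" and "nontrivial_rep u" and "finite_support u"
  shows "\<exists>!r. valid_tuple r \<and> equivalent_rep u (u_tuple r)"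
proof -
  have u: "well_formed u" using assms(1) unfolding linked_chain_def by simp
  obtain lo hi where
    "\<And>i. i < lo \<Longrightarrow> carrier_vec (dim u i) \<subseteq> image_of (downm u i)"
    "\<And>i. hi \<le> i \<Longrightarrow> carrier_vec (dim u (i + 1)) \<subseteq> image_of (upm u i)"
    using finite_support_bounds[OF u assms(4)] by blast
  then interpret exact_linked_chain u lo hi
    using assms(1,2) by unfold_locales
  have "\<exists>r. valid_tuple r \<and> equivalent_rep u (u_tuple r)"
    using exists_equivalent_u_tuple assms(3) unfolding nontrivial_rep_def N_def by blast
  then show ?thesis using u_tuple_equivalence_unique[OF u] by blast
qed

end
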